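(* Let $(X,G)$ be a minimal group action. Then the following statements are equivalent: (1) There exists a point $x\in X$ with finite stabilizer. (2) There exists an almost normal finite subgroup $H$ of $G$ such that $x\in X$ has trivial holonomy if and only if $G_x=gHg^{-1}$ for some $g\in G$. (3) The stabilizer URS of $(X,G)$ is a finite set of subgroups in $S(G)$. (4) Suppose, in addition, $X$ has a metric $d$. Then the action $(X,G)$ is locally quasi-analytic, and there exists a point $x\in X$ with a finite stabilizer. (That is, (4) is included in the equivalence under the additional assumption that $X$ has a metric $d$.)
   Context: A dynamical system (or group action) $(X,G)$ is a countable discrete finitely generated group $G$ acting by homeomorphisms on a compact Hausdorff space $X$. It is minimal if $X$ is the only non-empty closed $G$-invariant subset of $X$ (equivalently, every orbit is dense). The stabilizer of $x\in X$ is $G_x=\{g\in G: gx=x\}$. A subgroup $H$ of $G$ is almost normal if its normalizer $N_G(H)$ has finite index in $G$ (equivalently, $H$ has finitely many conjugates in $G$). A point $x\in X$ has trivial holonomy if for every $g\in G_x$ there is an open neighborhood $V$ of $x$ such that $g$ fixes every point of $V$. $S(G)$ is the space of all subgroups of $G$ with the Chabauty--Fell topology, which has a basis of open sets $U(A,B)=\{K\in S(G): A\subset K,\ B\cap K=\emptyset\}$ for finite $A,B\subset G$; $G$ acts on $S(G)$ by conjugation. The stabilizer URS (uniformly recurrent subgroup) of a minimal system $(X,G)$ is the closure in $S(G)$ of $\{G_x : x\in X \text{ has trivial holonomy}\}$; it is the unique minimal closed conjugation-invariant subset of the closure of $\{G_x:x\in X\}$ in $S(G)$. Metrics on $X$ are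 assumed compatible with the topology of $X$. Given such a metric $d$, the action $(X,G)$ is locally quasi-analytic if there is $\epsilon>0$ such that for every open $U\subset X$ with $\mathrm{diam}(U)<\epsilon$ and every $g\in G$: if $g|V=\mathrm{id}$ for some non-empty open $V\subset U$, then $g|U=\mathrm{id}$.
   Formalization: Statement (3) is read as "the stabilizer URS is a finite set of finite subgroups": as worded, (3) does not imply (1), since the integers acting trivially on one point have the finite stabilizer URS {Z} but no finite stabilizer. *)

theory Defs
  imports "HOL-Analysis.Analysis" "HOL-Algebra.Group_Action" "HOL-Algebra.Generated_Groups"
begin

text \<open>
  The library locale \<^locale>\<open>group_action\<close> makes every \<open>\<phi> g\<close> a bijection of \<open>topspace X\<close>.
  Continuity of each \<open>\<phi> g\<close> would already give homeomorphisms, as \<open>\<phi> (inv g)\<close> inverts \<open>\<phi> g\<close>.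
\<close>

definition finitely_generated_group :: "('g, 'm) monoid_scheme \<Rightarrow> bool" where
  "finitely_generated_group G \<longleftrightarrow>
     group G \<and> (\<exists>S. finite S \<and> S \<subseteq> carrier G \<and> generate G S = carrier G)"

definition dynamical_system ::
  "('g, 'm) monoid_scheme \<Rightarrow> 'x topology \<Rightarrow> ('g \<Rightarrow> 'x \<Rightarrow> 'x) \<Rightarrow> bool" where
  "dynamical_system G X \<phi> \<longleftrightarrow>
     finitely_generated_group G \<and> countable (carrier G) \<and>
     compact_space X \<and> Hausdorff_space X \<and>
     group_action G (topspace X) \<phi> \<and>
     (\<forall>g\<in>carrier G. homeomorphic_map X X (\<phi> g))"

definition minimal_system ::
  "('g, 'm) monoid_scheme \<Rightarrow> 'x topology \<Rightarrow> ('g \<Rightarrow> 'x \<Rightarrow> 'x) \<Rightarrow> bool" where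
  "minimal_system G X \<phi> \<longleftrightarrow>
     dynamical_system G X \<phi> \<and> topspace X \<noteq> {} \<and>
     (\<forall>C. closedin X C \<and> C \<noteq> {} \<and> (\<forall>g\<in>carrier G. \<phi> g ` C \<subseteq> C) \<longrightarrow> C = topspace X)"

definition almost_normal :: "('g, 'm) monoid_scheme \<Rightarrow> 'g set \<Rightarrow> bool" where
  "almost_normal G H \<longleftrightarrow> subgroup H G \<and> finite (rcosets\<^bsub>G\<^esub> (normalizer G H))"

definition trivial_holonomy ::
  "('g, 'm) monoid_scheme \<Rightarrow> 'x topology \<Rightarrow> ('g \<Rightarrow> 'x \<Rightarrow> 'x) \<Rightarrow> 'x \<Rightarrow> bool" where
  "trivial_holonomy G X \<phi> x \<longleftrightarrow>
     (\<forall>g\<in>stabilizer G \<phi> x. \<exists>V. openin X V \<and> x \<in> V \<and> (\<forall>y\<in>V. \<phi> g y = y))"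

text \<open>
  The sets \<open>U(A,B)\<close> are closed under binary intersection and \<open>U({},{})\<close> is the set of all
  subgroups, so they form a basis of the topology they generate.
\<close>

definition chabauty_basic :: "('g, 'm) monoid_scheme \<Rightarrow> 'g set \<Rightarrow> 'g set \<Rightarrow> 'g set set" where
  "chabauty_basic G A B = {K. subgroup K G \<and> A \<subseteq> K \<and> B \<inter> K = {}}"

definition chabauty :: "('g, 'm) monoid_scheme \<Rightarrow> 'g set topology" where
  "chabauty G = topology_generated_by
     {chabauty_basic G A B | A B. finite A \<and> A \<subseteq> carrier G \<and> finite B \<and> B \<subseteq> carrier G}"

definition stabilizer_URS ::
  "('g, 'm) monoid_scheme \<Rightarrow> 'x topology \<Rightarrow> ('g \<Rightarrow> 'x \<Rightarrow> 'x) \<Rightarrow> 'g set set" where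
  "stabilizer_URS G X \<phi> =
     chabauty G closure_of {stabilizer G \<phi> x | x. x \<in> topspace X \<and> trivial_holonomy G X \<phi> x}"

text \<open>
  A stabilizer URS can be a finite set all of whose members are infinite: for the trivial action
  of the integers on a point it consists of the whole group. Finiteness of the URS is therefore
  not enough to obtain a point with finite stabilizer; the members must be finite as well.
\<close>

text \<open>The counterpart of \<^const>\<open>diameter\<close> for a metric that is not a type class instance.\<close>

definition diam :: "('x \<Rightarrow> 'x \<Rightarrow> real) \<Rightarrow> 'x set \<Rightarrow> real" where
  "diam d S = (if S = {} then 0 else SUP (x, y)\<in>S \<times> S. d x y)"

definition compatible_metric :: "'x topology \<Rightarrow> ('x \<Rightarrow> 'x \<Rightarrow> real) \<Rightarrow> bool" where
  "compatible_metric X d \<longleftrightarrow>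
     Metric_space (topspace X) d \<and> Metric_space.mtopology (topspace X) d = X"

definition locally_quasi_analytic ::
  "('g, 'm) monoid_scheme \<Rightarrow> 'x topology \<Rightarrow> ('g \<Rightarrow> 'x \<Rightarrow> 'x) \<Rightarrow> ('x \<Rightarrow> 'x \<Rightarrow> real) \<Rightarrow> bool" where
  "locally_quasi_analytic G X \<phi> d \<longleftrightarrow>
     (\<exists>\<epsilon>>0. \<forall>U. openin X U \<and> diam d U < \<epsilon> \<longrightarrow>
        (\<forall>g\<in>carrier G.
           (\<exists>V. openin X V \<and> V \<noteq> {} \<and> V \<subseteq> U \<and> (\<forall>y\<in>V. \<phi> g y = y)) \<longrightarrow>
           (\<forall>y\<in>U. \<phi> g y = y)))"

end

theory Submission
  imports Defs
begin

text \<open>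
  Points of trivial holonomy always exist, by Baire's theorem. This alone derives a finite
  stabilizer from the existence of \<open>H\<close>, or from a URS with finite members.

  Conversely, let some point \<open>x\<close> have a finite stabilizer and let \<open>y\<close> have trivial holonomy. Any
  finite set of elements fixing \<open>y\<close> fixes a neighborhood of \<open>y\<close>, which the dense orbit of \<open>x\<close>
  meets; so the set is contained in a conjugate of the stabilizer of \<open>x\<close>. Hence the stabilizer \<open>F\<close>
  of \<open>y\<close> is finite too, and it fixes pointwise a whole neighborhood \<open>W\<close> of \<open>y\<close>. By minimality and
  compactness finitely many translates \<open>gW\<close> cover \<open>X\<close>, and \<open>gFg\<inverse>\<close> fixes \<open>gW\<close> pointwise.

  Everything follows from this cover by counting: every stabilizer of a point in \<open>gW\<close> contains
  \<open>gFg\<inverse>\<close>, so if it is itself conjugate to \<open>F\<close>, it equals \<open>gFg\<inverse>\<close>.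
  Applied to the points \<open>hy\<close>, this shows that \<open>F\<close> has only finitely many conjugates
  (\<open>finite_conjugates\<close>). Applied to a point \<open>x\<close> with stabilizer conjugate to \<open>F\<close>, it
  shows that this stabilizer fixes a neighborhood of \<open>x\<close>; and two points of trivial holonomy have
  conjugate stabilizers, since each stabilizer contains a conjugate of the other
  (\<open>trivial_holonomy_iff_conjugate\<close>). The URS is then the closure of a finite set of subgroups,
  which is closed because the Chabauty topology is Hausdorff. Finally, an element that fixes a
  nonempty open part of \<open>gW\<close> fixes some \<open>hy\<close> in \<open>gW\<close>, hence lies in \<open>gFg\<inverse>\<close> and fixes all of
  \<open>gW\<close>; a Lebesgue number of the cover turns this into local quasi-analyticity.
\<close>


section \<open>Conjugates of subsets of a group\<close>

lemma (in group) conjugate_eq_image: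
  "g <# H #> inv g = (\<lambda>h. g \<otimes> h \<otimes> inv g) ` H"
  by (auto simp: l_coset_def r_coset_def)

lemma (in group) card_conjugate:
  assumes "g \<in> carrier G" "H \<subseteq> carrier G"
  shows "card (g <# H #> inv g) = card H"
proof -
  have "inj_on (\<lambda>h. g \<otimes> h \<otimes> inv g) H"
    using assms conjugation_is_inj by (intro inj_onI) (metis subset_iff)
  then show ?thesis
    by (simp add: conjugate_eq_image card_image)
qed

text \<open>
  The normalizer is by definition the stabilizer of \<open>H\<close> under conjugation of subsets, so the
  orbit-stabilizer bijection turns a bound on the conjugates into a bound on the index.
\<close>

lemma (in group) almost_normal_if_finitely_many_conjugates:
  assumes "subgroup H G" "finite {g <# H #> inv g | g. g \<in> carrier G}"
  shows "almost_normal G H"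
proof -
  let ?c = "\<lambda>g. \<lambda>H \<in> {H. H \<subseteq> carrier G}. g <# H #> inv g"
  interpret conj: group_action G "{H. H \<subseteq> carrier G}" ?c
    by (rule action_by_conjugation_on_power_set)
  have H: "H \<in> {H. H \<subseteq> carrier G}"
    using assms(1) by (auto dest: subgroup.subset)
  have "orbit G ?c H = {g <# H #> inv g | g. g \<in> carrier G}"
    using H by (auto simp: orbit_def)
  with assms(2) have "finite (orbit G ?c H)"
    by simp
  moreover have "bij_betw (\<lambda>R. ?c (inv (SOME h. h \<in> R)) H) (rcosets (normalizer G H)) (orbit G ?c H)"
    using conj.orbit_stab_fun_is_bij[OF H] by (simp add: normalizer_def)
  ultimately have "finite (rcosets (normalizer G H))"
    by (simp add: bij_betw_finite)
  with assms(1) show ?thesis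
    by (simp add: almost_normal_def)
qed


section \<open>The space of subgroups\<close>

lemma topspace_chabauty: "topspace (chabauty G) = {K. subgroup K G}"
proof -
  have "chabauty_basic G {} {} \<in> {chabauty_basic G A B | A B.
      finite A \<and> A \<subseteq> carrier G \<and> finite B \<and> B \<subseteq> carrier G}"
    by blast
  then show ?thesis
    by (auto simp: chabauty_def chabauty_basic_def)
qed

lemma openin_chabauty_basic:
  assumes "finite A" "A \<subseteq> carrier G" "finite B" "B \<subseteq> carrier G"
  shows "openin (chabauty G) (chabauty_basic G A B)"
  unfolding chabauty_def using assms by (intro topology_generated_by_Basis) blast

lemma Hausdorff_space_chabauty: "Hausdorff_space (chabauty G)"
proof -
  \<comment> \<open>An element of exactly one of two subgroups separates them.\<close>
  have separated: "\<exists>U V. openin (chabauty G) U \<and> openin (chabauty G) V \<and> K \<in> U \<and> L \<in> V \<and> disjnt U V"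
    if "subgroup K G" "subgroup L G" "g \<in> K" "g \<notin> L" for K L g
  proof (intro exI conjI)
    have "g \<in> carrier G"
      using that by (auto dest: subgroup.subset)
    then show "openin (chabauty G) (chabauty_basic G {g} {})"
      "openin (chabauty G) (chabauty_basic G {} {g})"
      by (auto intro!: openin_chabauty_basic)
  qed (use that in \<open>auto simp: chabauty_basic_def disjnt_def\<close>)
  show ?thesis
    unfolding Hausdorff_space_def topspace_chabauty
  proof (intro allI impI)
    fix K L assume "K \<in> {K. subgroup K G} \<and> L \<in> {K. subgroup K G} \<and> K \<noteq> L"
    then obtain g where *: "subgroup K G" "subgroup L G" "g \<in> K \<and> g \<notin> L \<or> g \<in> L \<and> g \<notin> K"
      by auto
    then show "\<exists>U V. openin (chabauty G) U \<and> openin (chabauty G) V \<and> K \<in> U \<and> L \<in> V \<and> disjnt U V"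
      using separated[of K L g] separated[of L K g] by (meson disjnt_sym)
  qed
qed


section \<open>Minimal actions\<close>

locale minimal_action =
  fixes G :: "('g, 'm) monoid_scheme" (structure)
    and X :: "'x topology"
    and \<phi> :: "'g \<Rightarrow> 'x \<Rightarrow> 'x"
  assumes minimal: "minimal_system G X \<phi>"

sublocale minimal_action \<subseteq> group G
  using minimal by (simp add: minimal_system_def dynamical_system_def finitely_generated_group_def)

sublocale minimal_action \<subseteq> group_action G "topspace X" \<phi>
  using minimal by (simp add: minimal_system_def dynamical_system_def)

context minimal_action
begin

lemma compact: "compact_space X"
  and Hausdorff: "Hausdorff_space X"
  and countable_group: "countable (carrier G)"
  and nonempty: "topspace X \<noteq> {}"
  and homeomorphic: "g \<in> carrier G \<Longrightarrow> homeomorphic_map X X (\<phi> g)"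
  using minimal by (auto simp: minimal_system_def dynamical_system_def)

lemma act_closed: "g \<in> carrier G \<Longrightarrow> x \<in> topspace X \<Longrightarrow> \<phi> g x \<in> topspace X"
  using element_image by blast

lemma act_inv_act: "g \<in> carrier G \<Longrightarrow> x \<in> topspace X \<Longrightarrow> \<phi> (inv g) (\<phi> g x) = x"
  using orbit_sym_aux by blast

lemma act_conjugate:
  assumes "g \<in> carrier G" "h \<in> carrier G" "x \<in> topspace X"
  shows "\<phi> (g \<otimes> h \<otimes> inv g) (\<phi> g x) = \<phi> g (\<phi> h x)"
  using assms by (simp add: composition_rule act_closed act_inv_act)

lemma stabilizer_translate:
  assumes g: "g \<in> carrier G" and x: "x \<in> topspace X"
  shows "stabilizer G \<phi> (\<phi> g x) = g <# stabilizer G \<phi> x #> inv g"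
proof (intro equalityI subsetI)
  fix k assume k: "k \<in> stabilizer G \<phi> (\<phi> g x)"
  then have kc: "k \<in> carrier G" and fixed: "\<phi> k (\<phi> g x) = \<phi> g x"
    by (auto simp: stabilizer_def)
  let ?h = "inv g \<otimes> k \<otimes> g"
  have "\<phi> ?h x = x"
    using g x kc fixed by (simp add: composition_rule act_closed act_inv_act)
  then have "?h \<in> stabilizer G \<phi> x"
    using g kc by (simp add: stabilizer_def)
  moreover have "k = g \<otimes> ?h \<otimes> inv g"
  proof -
    have "g \<otimes> ?h = k \<otimes> g"
      using g kc by (simp add: m_assoc[symmetric])
    then show ?thesis
      using g kc by (simp add: m_assoc)
  qed
  ultimately show "k \<in> g <# stabilizer G \<phi> x #> inv g"
    unfolding conjugate_eq_image by blast
next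
  fix k assume "k \<in> g <# stabilizer G \<phi> x #> inv g"
  then show "k \<in> stabilizer G \<phi> (\<phi> g x)"
    using g x by (auto simp: conjugate_eq_image stabilizer_def act_conjugate)
qed

lemma openin_translate:
  assumes "g \<in> carrier G" "openin X V"
  shows "openin X (\<phi> g ` V)"
  using assms homeomorphic homeomorphic_imp_open_map open_map_def by metis

text \<open>The points outside all translates form a proper closed invariant set, which is empty.\<close>

lemma translates_cover:
  assumes V: "openin X V" "V \<noteq> {}"
  shows "topspace X \<subseteq> (\<Union>g\<in>carrier G. \<phi> g ` V)"
proof -
  let ?C = "topspace X - (\<Union>g\<in>carrier G. \<phi> g ` V)"
  have VX: "V \<subseteq> topspace X"
    using V openin_subset by blast
  have closed: "closedin X ?C"
    using V by (intro closedin_diff) (auto intro: openin_translate)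
  have invariant: "\<phi> k ` ?C \<subseteq> ?C" if k: "k \<in> carrier G" for k
  proof
    fix z assume "z \<in> \<phi> k ` ?C"
    then obtain x where x: "x \<in> ?C" "z = \<phi> k x"
      by blast
    have "z \<notin> \<phi> g ` V" if g: "g \<in> carrier G" for g
    proof
      assume "z \<in> \<phi> g ` V"
      then obtain v where v: "v \<in> V" "\<phi> k x = \<phi> g v"
        unfolding x(2) by blast
      have "x = \<phi> (inv k) (\<phi> g v)"
        using act_inv_act[OF k, of x] x v by simp
      also have "\<dots> = \<phi> (inv k \<otimes> g) v"
        using k g v VX by (subst composition_rule) auto
      finally have "x \<in> \<phi> (inv k \<otimes> g) ` V"
        using v(1) by blast
      moreover have "inv k \<otimes> g \<in> carrier G"
        using k g by simp
      ultimately show False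
        using x(1) by blast
    qed
    moreover have "z \<in> topspace X"
      using x k act_closed by simp
    ultimately show "z \<in> ?C"
      by blast
  qed
  have "\<phi> \<one> ` V = V"
    using VX by (simp add: id_eq_one[symmetric] subset_iff)
  then have "V \<subseteq> (\<Union>g\<in>carrier G. \<phi> g ` V)"
    by blast
  then have "?C \<noteq> topspace X"
    using V(2) VX by blast
  moreover have "\<forall>C. closedin X C \<and> C \<noteq> {} \<and> (\<forall>k\<in>carrier G. \<phi> k ` C \<subseteq> C) \<longrightarrow> C = topspace X"
    using minimal by (simp add: minimal_system_def)
  ultimately have "?C = {}"
    using closed invariant by metis
  then show ?thesis
    by blast
qed

lemma finitely_many_translates_cover:
  assumes "openin X V" "V \<noteq> {}"
  obtains K where "finite K" "K \<subseteq> carrier G" "topspace X \<subseteq> (\<Union>g\<in>K. \<phi> g ` V)"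
proof -
  have "\<forall>U\<in>(\<lambda>g. \<phi> g ` V) ` carrier G. openin X U"
    using assms openin_translate by blast
  then obtain \<F> where \<F>: "finite \<F>" "\<F> \<subseteq> (\<lambda>g. \<phi> g ` V) ` carrier G" "topspace X \<subseteq> \<Union>\<F>"
    using compact translates_cover[OF assms] unfolding compact_space_alt by metis
  then obtain K where "K \<subseteq> carrier G" "finite K" "\<F> = (\<lambda>g. \<phi> g ` V) ` K"
    using finite_subset_image by metis
  with \<F> that show thesis
    by blast
qed

lemma orbit_meets_open:
  assumes "openin X V" "V \<noteq> {}" "x \<in> topspace X"
  obtains h where "h \<in> carrier G" "\<phi> h x \<in> V"
proof -
  obtain g v where g: "g \<in> carrier G" "v \<in> V" "x = \<phi> g v"
    using translates_cover[OF assms(1,2)] assms(3) by blast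
  then have "\<phi> (inv g) x = v"
    using act_inv_act assms(1) openin_subset by blast
  with g that[of "inv g"] show thesis
    by simp
qed


section \<open>Points with trivial holonomy\<close>

text \<open>
  A point at which some \<open>g\<close> of its stabilizer moves points in every neighborhood lies on the
  frontier of the closed set of fixed points of \<open>g\<close>. Such a frontier has empty interior, and there
  are only countably many of them, so by Baire's theorem they do not cover \<open>X\<close>.
\<close>

lemma exists_trivial_holonomy:
  obtains x where "x \<in> topspace X" "trivial_holonomy G X \<phi> x"
proof -
  let ?Fix = "invariants (topspace X) \<phi>"
  let ?B = "(\<lambda>g. X frontier_of (?Fix g)) ` carrier G"
  have closed: "closedin X (?Fix g)" if "g \<in> carrier G" for g
    unfolding invariants_def
    using closedin_continuous_maps_eq[OF Hausdorff, of X "\<phi> g" "\<lambda>x. x"]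
      homeomorphic_imp_continuous_map[OF homeomorphic[OF that]] by simp
  have meagre: "X interior_of \<Union>?B = {}"
  proof (rule Baire_category_alt)
    show "completely_metrizable_space X \<or> locally_compact_space X \<and> regular_space X"
      using compact Hausdorff compact_Hausdorff_imp_regular_space compact_imp_locally_compact_space
      by blast
    show "countable ?B"
      using countable_group by simp
    show "closedin X T \<and> X interior_of T = {}" if "T \<in> ?B" for T
    proof -
      obtain g where g: "g \<in> carrier G" "T = X frontier_of (?Fix g)"
        using \<open>T \<in> ?B\<close> by blast
      have "X interior_of T \<subseteq> X interior_of (?Fix g)"
        unfolding g(2) by (intro interior_of_mono frontier_of_subset_closedin closed g(1))
      moreover have "X interior_of T \<inter> X interior_of (?Fix g) = {}"
        using interior_of_subset[of X T] unfolding g(2) frontier_of_def by blast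
      ultimately show ?thesis
        using closedin_frontier_of g(2) by blast
    qed
  qed
  have "\<not> topspace X \<subseteq> \<Union>?B"
  proof
    assume "topspace X \<subseteq> \<Union>?B"
    then have "topspace X \<subseteq> X interior_of \<Union>?B"
      by (simp add: interior_of_maximal)
    with meagre nonempty show False
      by simp
  qed
  then obtain x where x: "x \<in> topspace X" "\<And>g. g \<in> carrier G \<Longrightarrow> x \<notin> X frontier_of (?Fix g)"
    by blast
  have "trivial_holonomy G X \<phi> x"
    unfolding trivial_holonomy_def
  proof
    fix g assume "g \<in> stabilizer G \<phi> x"
    then have g: "g \<in> carrier G" "x \<in> ?Fix g"
      using x(1) by (auto simp: stabilizer_def invariants_def)
    then have "x \<in> X interior_of (?Fix g)"
      using x closed by (auto simp: frontier_of_def closure_of_closedin)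
    then show "\<exists>V. openin X V \<and> x \<in> V \<and> (\<forall>y\<in>V. \<phi> g y = y)"
      unfolding interior_of_def invariants_def by blast
  qed
  with x(1) that show thesis
    by blast
qed

lemma trivial_holonomy_common_neighborhood:
  assumes "trivial_holonomy G X \<phi> x" "x \<in> topspace X" "finite A" "A \<subseteq> stabilizer G \<phi> x"
  obtains V where "openin X V" "x \<in> V" "\<And>g y. g \<in> A \<Longrightarrow> y \<in> V \<Longrightarrow> \<phi> g y = y"
proof -
  obtain V where V: "\<And>g. g \<in> A \<Longrightarrow> openin X (V g) \<and> x \<in> V g \<and> (\<forall>y\<in>V g. \<phi> g y = y)"
    using assms(1,4) unfolding trivial_holonomy_def by (metis subsetD)
  show thesis
  proof (rule that)
    \<comment> \<open>The factor \<open>topspace X\<close> is for an empty \<open>A\<close>, where the intersection would be all of the type.\<close>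
    show "openin X (topspace X \<inter> (\<Inter>g\<in>A. V g))"
      using openin_INT[of A X V] V assms(3) by (simp add: Int_commute)
  qed (use V assms(2) in auto)
qed

text \<open>
  Finitely many elements of the stabilizer of \<open>y\<close> fix a common neighborhood of \<open>y\<close>. The orbit of
  \<open>x\<close> enters that neighborhood, so they lie in one conjugate of the stabilizer of \<open>x\<close>. The order
  of the latter thus bounds the number of elements.
\<close>

lemma finite_stabilizer_if_trivial_holonomy:
  assumes x: "x \<in> topspace X" "finite (stabilizer G \<phi> x)"
    and y: "y \<in> topspace X" "trivial_holonomy G X \<phi> y"
  shows "finite (stabilizer G \<phi> y)"
proof (rule ccontr)
  assume "infinite (stabilizer G \<phi> y)"
  then obtain A where A: "A \<subseteq> stabilizer G \<phi> y" "finite A" "card A = Suc (card (stabilizer G \<phi> x))"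
    using infinite_arbitrarily_large by metis
  obtain V where V: "openin X V" "y \<in> V" "\<And>g z. g \<in> A \<Longrightarrow> z \<in> V \<Longrightarrow> \<phi> g z = z"
    using trivial_holonomy_common_neighborhood[OF y(2,1) A(2,1)] by metis
  obtain h where h: "h \<in> carrier G" "\<phi> h x \<in> V"
    using orbit_meets_open[OF V(1) _ x(1)] V(2) by blast
  have "A \<subseteq> h <# stabilizer G \<phi> x #> inv h"
    using stabilizer_translate[OF h(1) x(1)] V(3) h(2) A(1) by (auto simp: stabilizer_def)
  moreover have "finite (h <# stabilizer G \<phi> x #> inv h)"
    using x(2) by (simp add: conjugate_eq_image)
  ultimately have "card A \<le> card (h <# stabilizer G \<phi> x #> inv h)"
    by (simp add: card_mono)
  with A(3) show False
    using card_conjugate[OF h(1) stabilizer_subset] by simp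
qed

end


section \<open>The neighborhood fixed by a finite stabilizer\<close>

text \<open>
  A point \<open>y\<close> of trivial holonomy with finite stabilizer \<open>F\<close> comes with a neighborhood \<open>W\<close> that
  \<open>F\<close> fixes pointwise. Then \<open>gFg\<inverse>\<close> fixes \<open>gW\<close> pointwise, and the sets \<open>gW\<close> cover \<open>X\<close>.
\<close>

locale finite_holonomy_free_point = minimal_action +
  fixes y W
  assumes point: "y \<in> topspace X"
    and finite_stabilizer: "finite (stabilizer G \<phi> y)"
    and open_neighborhood: "openin X W" "y \<in> W"
    and fixes_neighborhood: "g \<in> stabilizer G \<phi> y \<Longrightarrow> w \<in> W \<Longrightarrow> \<phi> g w = w"
begin

abbreviation F where "F \<equiv> stabilizer G \<phi> y"

abbreviation conjugate where "conjugate g \<equiv> g <# F #> inv g"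

lemma finite_conjugate: "finite (conjugate g)"
  using finite_stabilizer by (simp add: conjugate_eq_image)

lemma fixes_translate:
  assumes "g \<in> carrier G" "k \<in> conjugate g" "x \<in> \<phi> g ` W"
  shows "\<phi> k x = x"
proof -
  obtain f w where f: "f \<in> F" "k = g \<otimes> f \<otimes> inv g" and w: "w \<in> W" "x = \<phi> g w"
    using assms by (auto simp: conjugate_eq_image)
  moreover have "f \<in> carrier G" "w \<in> topspace X"
    using f w stabilizer_subset open_neighborhood openin_subset by blast+
  ultimately show ?thesis
    using assms(1) by (simp add: act_conjugate fixes_neighborhood)
qed

lemma conjugate_subset_stabilizer:
  assumes "g \<in> carrier G" "x \<in> \<phi> g ` W"
  shows "conjugate g \<subseteq> stabilizer G \<phi> x"
proof
  fix k assume k: "k \<in> conjugate g"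
  then have "k \<in> carrier G"
    using assms(1) stabilizer_subset by (auto simp: conjugate_eq_image)
  then show "k \<in> stabilizer G \<phi> x"
    using fixes_translate[OF assms(1) k assms(2)] by (simp add: stabilizer_def)
qed

text \<open>All conjugates of \<open>F\<close> have the same finite order, so an inclusion between them is an equality.\<close>

lemma conjugate_stabilizer_on_translate:
  assumes "g \<in> carrier G" "x \<in> \<phi> g ` W" "h \<in> carrier G" "stabilizer G \<phi> x = conjugate h"
  shows "conjugate h = conjugate g"
proof -
  have "conjugate g \<subseteq> conjugate h"
    using conjugate_subset_stabilizer[OF assms(1,2)] assms(4) by simp
  moreover have "card (conjugate g) = card (conjugate h)"
    using assms card_conjugate[OF _ stabilizer_subset] by simp
  ultimately show ?thesis
    using card_subset_eq[OF finite_conjugate] by metis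
qed

lemma neighborhood_nonempty: "W \<noteq> {}"
  using open_neighborhood(2) by blast

lemma in_translate:
  assumes "x \<in> topspace X"
  obtains g where "g \<in> carrier G" "x \<in> \<phi> g ` W"
  using subsetD[OF translates_cover[OF open_neighborhood(1) neighborhood_nonempty] assms] that
  by (elim UN_E)

text \<open>
  The conjugate by \<open>h\<close> is the stabilizer of \<open>\<phi> h y\<close>, hence equals the conjugate belonging to any
  translate of \<open>W\<close> around \<open>\<phi> h y\<close>; finitely many translates suffice.
\<close>

lemma finite_conjugates: "finite {conjugate g | g. g \<in> carrier G}"
proof -
  obtain K where K: "finite K" "K \<subseteq> carrier G" "topspace X \<subseteq> (\<Union>g\<in>K. \<phi> g ` W)"
    by (rule finitely_many_translates_cover[OF open_neighborhood(1) neighborhood_nonempty])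
  have "conjugate h \<in> conjugate ` K" if h: "h \<in> carrier G" for h
  proof -
    obtain g where g: "g \<in> K" "\<phi> h y \<in> \<phi> g ` W"
      using subsetD[OF K(3) act_closed[OF h point]] by (elim UN_E)
    then have "conjugate h = conjugate g"
      using K(2) by (intro conjugate_stabilizer_on_translate[OF _ _ h stabilizer_translate[OF h point]]) auto
    with g(1) show ?thesis
      by simp
  qed
  then have "{conjugate g | g. g \<in> carrier G} \<subseteq> conjugate ` K"
    by blast
  with K(1) show ?thesis
    by (simp add: finite_subset)
qed

lemma trivial_holonomy_if_conjugate:
  assumes x: "x \<in> topspace X" and h: "h \<in> carrier G" "stabilizer G \<phi> x = conjugate h"
  shows "trivial_holonomy G X \<phi> x"
proof -
  obtain g where g: "g \<in> carrier G" "x \<in> \<phi> g ` W"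
    by (rule in_translate[OF x])
  have "stabilizer G \<phi> x = conjugate g"
    using h(2) conjugate_stabilizer_on_translate[OF g h] by (rule trans)
  then have "\<forall>z\<in>\<phi> g ` W. \<phi> k z = z" if "k \<in> stabilizer G \<phi> x" for k
    using that fixes_translate[OF g(1)] by blast
  then show ?thesis
    unfolding trivial_holonomy_def
    using g(2) openin_translate[OF g(1) open_neighborhood(1)] by blast
qed

text \<open>
  The roles of \<open>y\<close> and a second point \<open>z\<close> of trivial holonomy are symmetric: each stabilizer
  contains a conjugate of the other, and finiteness forces equality.
\<close>

lemma conjugate_if_trivial_holonomy:
  assumes z: "z \<in> topspace X" "trivial_holonomy G X \<phi> z"
  obtains g where "g \<in> carrier G" "stabilizer G \<phi> z = conjugate g"
proof -
  have fin: "finite (stabilizer G \<phi> z)"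
    using finite_stabilizer_if_trivial_holonomy[OF point finite_stabilizer z] .
  obtain V where V: "openin X V" "z \<in> V" "\<And>g w. g \<in> stabilizer G \<phi> z \<Longrightarrow> w \<in> V \<Longrightarrow> \<phi> g w = w"
    using trivial_holonomy_common_neighborhood[OF z(2,1) fin order_refl] by metis
  interpret z: finite_holonomy_free_point G X \<phi> z V
    using z(1) fin V by unfold_locales auto
  obtain g where g: "g \<in> carrier G" "z \<in> \<phi> g ` W"
    by (rule in_translate[OF z(1)])
  obtain h where h: "h \<in> carrier G" "y \<in> \<phi> h ` V"
    by (rule z.in_translate[OF point])
  have "card (stabilizer G \<phi> z) = card (z.conjugate h)"
    using card_conjugate[OF h(1) stabilizer_subset] by simp
  also have "\<dots> \<le> card F"
    using z.conjugate_subset_stabilizer[OF h] finite_stabilizer by (simp add: card_mono)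
  also have "\<dots> = card (conjugate g)"
    using card_conjugate[OF g(1) stabilizer_subset] by simp
  finally have "conjugate g = stabilizer G \<phi> z"
    using conjugate_subset_stabilizer[OF g] fin by (intro card_seteq)
  with g(1) that show thesis
    by simp
qed

lemma trivial_holonomy_iff_conjugate:
  assumes "x \<in> topspace X"
  shows "trivial_holonomy G X \<phi> x \<longleftrightarrow> (\<exists>g\<in>carrier G. stabilizer G \<phi> x = conjugate g)"
  using assms trivial_holonomy_if_conjugate conjugate_if_trivial_holonomy by metis

lemma almost_normal_stabilizer: "almost_normal G F"
  using almost_normal_if_finitely_many_conjugates[OF stabilizer_subgroup[OF point] finite_conjugates] .

lemma stabilizer_URS_subset: "stabilizer_URS G X \<phi> \<subseteq> {conjugate g | g. g \<in> carrier G}"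
  unfolding stabilizer_URS_def
proof (rule closure_of_minimal)
  show "{stabilizer G \<phi> x | x. x \<in> topspace X \<and> trivial_holonomy G X \<phi> x}
      \<subseteq> {conjugate g | g. g \<in> carrier G}"
    using trivial_holonomy_iff_conjugate by blast
  have "subgroup (conjugate g) G" if "g \<in> carrier G" for g
    using stabilizer_subgroup[OF act_closed[OF that point]] stabilizer_translate[OF that point] by simp
  then show "closedin (chabauty G) {conjugate g | g. g \<in> carrier G}"
    by (intro closedin_Hausdorff_finite Hausdorff_space_chabauty finite_conjugates)
      (auto simp: topspace_chabauty)
qed

text \<open>
  An element \<open>k\<close> that fixes a nonempty open subset of \<open>gW\<close> fixes a point of the orbit of \<open>y\<close> in \<open>gW\<close>. The
  stabilizer of that point is a conjugate of \<open>F\<close>, hence the one that fixes all of \<open>gW\<close>.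
\<close>

lemma fixes_translate_if_fixes_open_subset:
  assumes g: "g \<in> carrier G" and V: "openin X V" "V \<noteq> {}" "V \<subseteq> \<phi> g ` W"
    and k: "k \<in> carrier G" "\<And>v. v \<in> V \<Longrightarrow> \<phi> k v = v"
    and x: "x \<in> \<phi> g ` W"
  shows "\<phi> k x = x"
proof -
  obtain h where h: "h \<in> carrier G" "\<phi> h y \<in> V"
    by (rule orbit_meets_open[OF V(1,2) point])
  have "k \<in> stabilizer G \<phi> (\<phi> h y)"
    using k h(2) by (simp add: stabilizer_def)
  also have "\<dots> = conjugate h"
    using stabilizer_translate[OF h(1) point] .
  also have "\<dots> = conjugate g"
    by (rule conjugate_stabilizer_on_translate[OF g subsetD[OF V(3) h(2)] h(1)
          stabilizer_translate[OF h(1) point]])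
  finally show ?thesis
    by (rule fixes_translate[OF g _ x])
qed

text \<open>
  A Lebesgue number of the cover by the translates of \<open>W\<close> witnesses local quasi-analyticity:
  every set of smaller diameter lies in one translate.
\<close>

lemma locally_quasi_analytic:
  assumes "compatible_metric X d"
  shows "locally_quasi_analytic G X \<phi> d"
proof -
  interpret M: Metric_space "topspace X" d
    using assms by (simp add: compatible_metric_def)
  have mtop: "M.mtopology = X"
    using assms by (simp add: compatible_metric_def)
  have compactin: "compactin M.mtopology (topspace X)"
    using compact by (simp add: mtop compact_space_def)
  obtain B where B: "\<And>u v. u \<in> topspace X \<Longrightarrow> v \<in> topspace X \<Longrightarrow> d u v \<le> B"
    using M.compactin_imp_mbounded[OF compactin] by (auto simp: M.mbounded_alt)
  let ?C = "(\<lambda>g. \<phi> g ` W) ` carrier G"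
  have "topspace X \<subseteq> \<Union>?C"
    using translates_cover[OF open_neighborhood(1) neighborhood_nonempty] by simp
  moreover have "openin M.mtopology U" if "U \<in> ?C" for U
    using that openin_translate open_neighborhood(1) by (auto simp: mtop)
  ultimately obtain \<epsilon> where \<epsilon>: "\<epsilon> > 0" "\<And>x. x \<in> topspace X \<Longrightarrow> \<exists>U\<in>?C. M.mball x \<epsilon> \<subseteq> U"
    using M.lebesgue_number[OF compactin, of ?C] by blast
  have "\<phi> k u = u"
    if U: "openin X U" "diam d U < \<epsilon>" and k: "k \<in> carrier G"
      and V: "openin X V" "V \<noteq> {}" "V \<subseteq> U" "\<forall>v\<in>V. \<phi> k v = v" and u: "u \<in> U" for U k V u
  proof -
    have UX: "U \<subseteq> topspace X"
      using U(1) openin_subset by blast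
    \<comment> \<open>Boundedness of the metric makes the supremum in the diameter a genuine upper bound.\<close>
    have "bdd_above ((\<lambda>(x, y). d x y) ` (U \<times> U))"
      using B UX by (intro bdd_aboveI[of _ B]) auto
    then have le: "d u v \<le> diam d U" if "v \<in> U" for v
      using that u cSUP_upper[of "(u, v)" "U \<times> U" "\<lambda>(x, y). d x y"] by (auto simp: diam_def)
    have in_ball: "U \<subseteq> M.mball u \<epsilon>"
    proof
      fix v assume "v \<in> U"
      then show "v \<in> M.mball u \<epsilon>"
        using le[of v] U(2) subsetD[OF UX] u by simp
    qed
    obtain g where g: "g \<in> carrier G" "M.mball u \<epsilon> \<subseteq> \<phi> g ` W"
      using \<epsilon>(2)[OF subsetD[OF UX u]] unfolding bex_simps by (elim bexE)
    have sub: "U \<subseteq> \<phi> g ` W"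
      using in_ball g(2) by (rule subset_trans)
    show ?thesis
      using fixes_translate_if_fixes_open_subset[OF g(1) V(1,2) subset_trans[OF V(3) sub] k _
          subsetD[OF sub u]] V(4) by blast
  qed
  then show ?thesis
    unfolding locally_quasi_analytic_def using \<epsilon>(1) by (intro exI[of _ \<epsilon>]) blast
qed

end

context minimal_action
begin

lemma obtain_finite_holonomy_free_point:
  assumes "x \<in> topspace X" "finite (stabilizer G \<phi> x)"
  obtains y W where "finite_holonomy_free_point G X \<phi> y W"
proof -
  obtain y where y: "y \<in> topspace X" "trivial_holonomy G X \<phi> y"
    using exists_trivial_holonomy by blast
  have fin: "finite (stabilizer G \<phi> y)"
    using finite_stabilizer_if_trivial_holonomy assms y by blast
  obtain W where W: "openin X W" "y \<in> W" "\<And>g w. g \<in> stabilizer G \<phi> y \<Longrightarrow> w \<in> W \<Longrightarrow> \<phi> g w = w"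
    using trivial_holonomy_common_neighborhood[OF y(2,1) fin order_refl] by metis
  have "finite_holonomy_free_point G X \<phi> y W"
    using y(1) fin W by unfold_locales auto
  with that show thesis .
qed

lemma stabilizer_in_URS:
  assumes "x \<in> topspace X" "trivial_holonomy G X \<phi> x"
  shows "stabilizer G \<phi> x \<in> stabilizer_URS G X \<phi>"
proof -
  have "{stabilizer G \<phi> x | x. x \<in> topspace X \<and> trivial_holonomy G X \<phi> x} \<subseteq> topspace (chabauty G)"
    using stabilizer_subgroup by (auto simp: topspace_chabauty)
  from closure_of_subset[OF this] assms show ?thesis
    unfolding stabilizer_URS_def by blast
qed

end


section \<open>The characterizations of a finite stabilizer\<close>

theorem theorem1p4:
  fixes G :: "('g, 'm) monoid_scheme"
    and X :: "'x topology"
    and \<phi> :: "'g \<Rightarrow> 'x \<Rightarrow> 'x"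
  assumes "minimal_system G X \<phi>"
  shows "((\<exists>x\<in>topspace X. finite (stabilizer G \<phi> x)) \<longleftrightarrow>
         (\<exists>H. almost_normal G H \<and> finite H \<and>
            (\<forall>x\<in>topspace X. trivial_holonomy G X \<phi> x \<longleftrightarrow>
               (\<exists>g\<in>carrier G. stabilizer G \<phi> x = g <#\<^bsub>G\<^esub> H #>\<^bsub>G\<^esub> inv\<^bsub>G\<^esub> g)))) \<and>
         ((\<exists>x\<in>topspace X. finite (stabilizer G \<phi> x)) \<longleftrightarrow>
         finite (stabilizer_URS G X \<phi>) \<and> (\<forall>K\<in>stabilizer_URS G X \<phi>. finite K)) \<and>
         (\<forall>d. compatible_metric X d \<longrightarrow>
           ((\<exists>x\<in>topspace X. finite (stabilizer G \<phi> x)) \<longleftrightarrow>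
            locally_quasi_analytic G X \<phi> d \<and> (\<exists>x\<in>topspace X. finite (stabilizer G \<phi> x))))"
proof -
  interpret minimal_action G X \<phi>
    using assms by unfold_locales
  let ?P1 = "\<exists>x\<in>topspace X. finite (stabilizer G \<phi> x)"
  let ?P2 = "\<exists>H. almost_normal G H \<and> finite H \<and>
            (\<forall>x\<in>topspace X. trivial_holonomy G X \<phi> x \<longleftrightarrow>
               (\<exists>g\<in>carrier G. stabilizer G \<phi> x = g <#\<^bsub>G\<^esub> H #>\<^bsub>G\<^esub> inv\<^bsub>G\<^esub> g))"
  let ?P3 = "finite (stabilizer_URS G X \<phi>) \<and> (\<forall>K\<in>stabilizer_URS G X \<phi>. finite K)"
  obtain x where x: "x \<in> topspace X" "trivial_holonomy G X \<phi> x"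
    using exists_trivial_holonomy by blast
  have from1: "?P2 \<and> ?P3 \<and> (\<forall>d. compatible_metric X d \<longrightarrow> locally_quasi_analytic G X \<phi> d)" if ?P1
  proof -
    obtain y W where "finite_holonomy_free_point G X \<phi> y W"
      using \<open>?P1\<close> obtain_finite_holonomy_free_point by blast
    then interpret finite_holonomy_free_point G X \<phi> y W .
    have ?P2
      using almost_normal_stabilizer finite_stabilizer trivial_holonomy_iff_conjugate by blast
    moreover have ?P3
      using stabilizer_URS_subset finite_conjugates finite_conjugate finite_subset by blast
    ultimately show ?thesis
      using locally_quasi_analytic by blast
  qed
  have "?P1" if "?P2"
  proof -
    obtain H g where "finite H" "stabilizer G \<phi> x = g <#\<^bsub>G\<^esub> H #>\<^bsub>G\<^esub> inv\<^bsub>G\<^esub> g"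
      using \<open>?P2\<close> x by blast
    then have "finite (stabilizer G \<phi> x)"
      by (simp add: conjugate_eq_image)
    with x(1) show ?thesis
      by blast
  qed
  moreover have "?P1" if "?P3"
    using that x stabilizer_in_URS by blast
  ultimately show ?thesis
    using from1 by blast
qed

end
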